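(* (Łoś theorem) Let $V\subseteq[0,1]$ be a Gödel set such that $(V,d_{max})$ is a compact Hausdorff space. Let $\{\mathcal{M}_i\}_{i\in I}$ be a family of $\mathcal{L}$-structures of the first-order Gödel logic $\mathfrak{G}_V$, let $\mathfrak{D}$ be an ultrafilter on $I$, and let $\mathcal{M}$ be the $\mathfrak{D}$-ultraproduct of $\{\mathcal{M}_i\}_{i\in I}$. Then for every $\mathcal{L}$-formula $\varphi(x_1,\dots,x_n)$ and all $\mathbf{a}_k=\{a^k_i\}_{i\in I}\in M$ ($1\le k\le n$), $$\varphi^{\mathcal{M}}(\mathbf{a}_1,\dots,\mathbf{a}_n)=\lim_{\mathfrak{D}}\varphi^{\mathcal{M}_i}(a^1_i,\dots,a^n_i).$$
   Context: $d_{max}$ denotes the metric on $[0,1]$ given by $d_{max}(x,y)=\max\{x,y\}$ if $x\ne y$ and $d_{max}(x,x)=0$. A Gödel set is a subset $V\subseteq[0,1]$ with $0,1\in V$, used as a set of truth values with $0$ meaning absolute truth (e.g. $V=\{1/n:n\in\mathbb{N}\}\cup\{0\}$). The first-order Gödel logic $\mathfrak{G}_V$ in the metric semantic: for a first-order language $\mathcal{L}$ (function and predicate symbols), an $\mathcal{L}$-structure $\mathcal{M}$ is a nonempty set $M$ with functions $f^{\mathcal{M}}:M^{n}\to M$ and predicates $R^{\mathcal{M}}:M^n\to V$; terms are interpreted as usual, and formulas built from atoms, $\bot$, $\&$, $\to$, $\wedge$, $\forall$, $\exists$ are interpreted by $\bot^{\mathcal{M}}=1$, $(\varphi\&\psi)^{\mathcal{M}}=(\varphi\wedge\psi)^{\mathcal{M}}=\max\{\varphi^{\mathcal{M}},\psi^{\mathcal{M}}\}$,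 $(\varphi\to\psi)^{\mathcal{M}}=0$ if $\varphi^{\mathcal{M}}\ge\psi^{\mathcal{M}}$ and $=\psi^{\mathcal{M}}$ otherwise, $(\forall y\,\psi)^{\mathcal{M}}(\bar a)=\sup_{b\in M}\psi^{\mathcal{M}}(b,\bar a)$, $(\exists y\,\psi)^{\mathcal{M}}(\bar a)=\inf_{b\in M}\psi^{\mathcal{M}}(b,\bar a)$. For a filter $\mathfrak{D}$ on $I$ and a family $\{x_i\}_{i\in I}$ in $V$, $\lim_{\mathfrak{D}}x_i=x$ means that for every $d_{max}$-open $U\subseteq V$ containing $x$, $\{i: x_i\in U\}\in\mathfrak{D}$ (for an ultrafilter and compact Hausdorff $V$ this limit exists and is unique). The $\mathfrak{D}$-ultraproduct $\mathcal{M}$ has universe $M=\prod_{i\in I}M_i$, with $f^{\mathcal{M}}(\{x^1_i\},\dots,\{x^n_i\})=\{f^{\mathcal{M}_i}(x^1_i,\dots,x^n_i)\}_{i\in I}$ and $R^{\mathcal{M}}(\{x^1_i\},\dots,\{x^n_i\})=\lim_{\mathfrak{D}}R^{\mathcal{M}_i}(x^1_i,\dots,x^n_i)$. *)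

theory Defs
  imports "HOL-Analysis.Analysis"
begin

section \<open>Goedel sets and the metric \<open>d_max\<close>\<close>

(* Only the values on [0,1] matter, where the absolute values disappear (dmax_unit_interval).
   They are there because Metric_space requires nonnegativity on the whole type. *)
definition dmax :: "real \<Rightarrow> real \<Rightarrow> real" where
  "dmax x y = (if x = y then 0 else max \<bar>x\<bar> \<bar>y\<bar>)"

lemma dmax_unit_interval:
  "x \<in> {0..1} \<Longrightarrow> y \<in> {0..1} \<Longrightarrow> dmax x y = (if x = y then 0 else max x y)"
  by (simp add: dmax_def)

lemma Metric_space_dmax: "Metric_space V dmax"
  by unfold_locales (auto simp: dmax_def max_def)

definition godel_set :: "real set \<Rightarrow> bool" where
  "godel_set V \<longleftrightarrow> V \<subseteq> {0..1} \<and> 0 \<in> V \<and> 1 \<in> V"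

definition dmax_topology :: "real set \<Rightarrow> real topology" where
  "dmax_topology V = Metric_space.mtopology V dmax"

section \<open>First-order syntax\<close>

record ('f, 'p) language =
  funs :: "'f set"
  preds :: "'p set"
  fun_arity :: "'f \<Rightarrow> nat"
  pred_arity :: "'p \<Rightarrow> nat"

datatype 'f fo_term = Var nat | App 'f "'f fo_term list"

datatype ('f, 'p) fo_form =
    Atom 'p "'f fo_term list"
  | Falsum
  | SConj "('f, 'p) fo_form" "('f, 'p) fo_form"  (* strong conjunction & *)
  | Impl "('f, 'p) fo_form" "('f, 'p) fo_form"
  | WConj "('f, 'p) fo_form" "('f, 'p) fo_form"  (* weak (lattice) conjunction *)
  | All nat "('f, 'p) fo_form"
  | Exi nat "('f, 'p) fo_form"

primrec is_term :: "('f, 'p) language \<Rightarrow> 'f fo_term \<Rightarrow> bool" where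
  "is_term L (Var x) \<longleftrightarrow> True"
| "is_term L (App f ts) \<longleftrightarrow>
     f \<in> funs L \<and> length ts = fun_arity L f \<and> list_all (is_term L) ts"

primrec is_formula :: "('f, 'p) language \<Rightarrow> ('f, 'p) fo_form \<Rightarrow> bool" where
  "is_formula L (Atom R ts) \<longleftrightarrow>
     R \<in> preds L \<and> length ts = pred_arity L R \<and> list_all (is_term L) ts"
| "is_formula L Falsum \<longleftrightarrow> True"
| "is_formula L (SConj \<phi> \<psi>) \<longleftrightarrow> is_formula L \<phi> \<and> is_formula L \<psi>"
| "is_formula L (Impl \<phi> \<psi>) \<longleftrightarrow> is_formula L \<phi> \<and> is_formula L \<psi>"
| "is_formula L (WConj \<phi> \<psi>) \<longleftrightarrow> is_formula L \<phi> \<and> is_formula L \<psi>"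
| "is_formula L (All y \<psi>) \<longleftrightarrow> is_formula L \<psi>"
| "is_formula L (Exi y \<psi>) \<longleftrightarrow> is_formula L \<psi>"

primrec term_vars :: "'f fo_term \<Rightarrow> nat set" where
  "term_vars (Var x) = {x}"
| "term_vars (App f ts) = \<Union>(set (map term_vars ts))"

primrec free_vars :: "('f, 'p) fo_form \<Rightarrow> nat set" where
  "free_vars (Atom R ts) = \<Union>(set (map term_vars ts))"
| "free_vars Falsum = {}"
| "free_vars (SConj \<phi> \<psi>) = free_vars \<phi> \<union> free_vars \<psi>"
| "free_vars (Impl \<phi> \<psi>) = free_vars \<phi> \<union> free_vars \<psi>"
| "free_vars (WConj \<phi> \<psi>) = free_vars \<phi> \<union> free_vars \<psi>"
| "free_vars (All y \<psi>) = free_vars \<psi> - {y}"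
| "free_vars (Exi y \<psi>) = free_vars \<psi> - {y}"

section \<open>Structures and interpretation (metric semantics: 0 is absolute truth)\<close>

record ('f, 'p, 'a) fo_struct =
  univ :: "'a set"
  fun_int :: "'f \<Rightarrow> 'a list \<Rightarrow> 'a"
  pred_int :: "'p \<Rightarrow> 'a list \<Rightarrow> real"

definition is_structure ::
  "real set \<Rightarrow> ('f, 'p) language \<Rightarrow> ('f, 'p, 'a) fo_struct \<Rightarrow> bool" where
  "is_structure V L M \<longleftrightarrow>
     univ M \<noteq> {} \<and>
     (\<forall>f\<in>funs L. \<forall>as. length as = fun_arity L f \<and> set as \<subseteq> univ M \<longrightarrow> fun_int M f as \<in> univ M) \<and>
     (\<forall>R\<in>preds L. \<forall>as. length as = pred_arity L R \<and> set as \<subseteq> univ M \<longrightarrow> pred_int M R as \<in> V)"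

primrec term_val :: "('f, 'p, 'a) fo_struct \<Rightarrow> (nat \<Rightarrow> 'a) \<Rightarrow> 'f fo_term \<Rightarrow> 'a" where
  "term_val M e (Var x) = e x"
| "term_val M e (App f ts) = fun_int M f (map (term_val M e) ts)"

primrec form_val :: "('f, 'p, 'a) fo_struct \<Rightarrow> (nat \<Rightarrow> 'a) \<Rightarrow> ('f, 'p) fo_form \<Rightarrow> real" where
  "form_val M e (Atom R ts) = pred_int M R (map (term_val M e) ts)"
| "form_val M e Falsum = 1"
| "form_val M e (SConj \<phi> \<psi>) = max (form_val M e \<phi>) (form_val M e \<psi>)"
| "form_val M e (Impl \<phi> \<psi>) =
     (if form_val M e \<phi> \<ge> form_val M e \<psi> then 0 else form_val M e \<psi>)"
| "form_val M e (WConj \<phi> \<psi>) = max (form_val M e \<phi>) (form_val M e \<psi>)"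
| "form_val M e (All y \<psi>) = (SUP b\<in>univ M. form_val M (e(y := b)) \<psi>)"
| "form_val M e (Exi y \<psi>) = (INF b\<in>univ M. form_val M (e(y := b)) \<psi>)"

(* The value of \<phi>(x_1,...,x_n) at (a_1,...,a_n), for xs = [x_1,...,x_n] distinct and containing
   the free variables of \<phi>, and as = [a_1,...,a_n]. Variables outside xs get an unspecified
   value, on which the result does not depend. *)
definition form_val_at ::
  "('f, 'p, 'a) fo_struct \<Rightarrow> ('f, 'p) fo_form \<Rightarrow> nat list \<Rightarrow> 'a list \<Rightarrow> real" where
  "form_val_at M \<phi> xs as = form_val M (\<lambda>x. the (map_of (zip xs as) x)) \<phi>"

section \<open>Ultrafilters, limits and ultraproducts\<close>

(* A filter on a set I is represented by a filter on the ambient index type that contains I;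
   "A belongs to D" is "eventually (\<lambda>i. i \<in> A) D". *)
definition ultrafilter_on :: "'i set \<Rightarrow> 'i filter \<Rightarrow> bool" where
  "ultrafilter_on I D \<longleftrightarrow>
     D \<noteq> bot \<and> eventually (\<lambda>i. i \<in> I) D \<and>
     (\<forall>A\<subseteq>I. eventually (\<lambda>i. i \<in> A) D \<or> eventually (\<lambda>i. i \<in> I - A) D)"

(* "lim_D x_i = x" is limitin (dmax_topology V) x_i x D; this is the limit as an operation. *)
definition filter_lim :: "real set \<Rightarrow> 'i filter \<Rightarrow> ('i \<Rightarrow> real) \<Rightarrow> real" where
  "filter_lim V D r = (THE l. limitin (dmax_topology V) r l D)"

definition ultraproduct ::
  "real set \<Rightarrow> 'i set \<Rightarrow> 'i filter \<Rightarrow> ('i \<Rightarrow> ('f, 'p, 'a) fo_struct) \<Rightarrow> ('f, 'p, 'i \<Rightarrow> 'a) fo_struct"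
where
  "ultraproduct V I D Ms =
     \<lparr> univ = (\<Pi>\<^sub>E i\<in>I. univ (Ms i)),
       fun_int = (\<lambda>f as. \<lambda>i\<in>I. fun_int (Ms i) f (map (\<lambda>a. a i) as)),
       pred_int = (\<lambda>R as. filter_lim V D (\<lambda>i. pred_int (Ms i) R (map (\<lambda>a. a i) as))) \<rparr>"

end

theory Submission
  imports Defs
begin

text \<open>Every nonzero point of \<open>V\<close> is isolated for \<open>dmax\<close>, so compactness means that
  \<open>V \<inter> {\<epsilon>..}\<close> is finite for each \<open>\<epsilon> > 0\<close>. Hence suprema in \<open>V\<close> are attained,
  infima stay in \<open>V\<close>, limits along an ultrafilter exist, and \<open>dmax\<close>-limits are also
  limits in the usual topology, hence monotone. In the induction on formulas, a universal quantifier
  is handled by choosing coordinatewise a point attaining the supremum, an existential one by choosing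
  coordinatewise a point within \<open>\<epsilon>\<close> of the infimum.\<close>

section \<open>Order structure of a compact Goedel set\<close>

lemma topspace_dmax [simp]: "topspace (dmax_topology V) = V"
  by (simp add: dmax_topology_def Metric_space.topspace_mtopology[OF Metric_space_dmax])

locale compact_godel_set =
  fixes V :: "real set"
  assumes godel: "godel_set V"
    and compact: "compact_space (dmax_topology V)"
begin

lemma zero_in: "0 \<in> V" and one_in: "1 \<in> V"
  and ge_zero: "x \<in> V \<Longrightarrow> 0 \<le> x" and le_one: "x \<in> V \<Longrightarrow> x \<le> 1"
  using godel by (auto simp: godel_set_def)

lemma bdd: "S \<subseteq> V \<Longrightarrow> bdd_above S" "S \<subseteq> V \<Longrightarrow> bdd_below S"
  by (meson bdd_above.I bdd_below.I le_one ge_zero subsetD)+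

text \<open>Compactness gives a finite \<open>\<epsilon>\<close>-net. A point \<open>y\<close> with
  \<open>\<epsilon> \<le> y\<close> has distance at least \<open>y\<close> to every other point of
  \<open>V\<close>, so the ball covering it must be centred at \<open>y\<close>: the net contains
  the whole upper part.\<close>

lemma finite_upper_part:
  assumes "0 < \<epsilon>"
  shows "finite {x \<in> V. \<epsilon> \<le> x}"
proof -
  interpret Metric_space V dmax by (rule Metric_space_dmax)
  have "mtotally_bounded V"
    using compact compactin_imp_mtotally_bounded
    by (simp add: compact_space_def dmax_topology_def)
  then obtain K where "finite K" and K: "V \<subseteq> (\<Union>x\<in>K. mball x \<epsilon>)"
    using assms unfolding mtotally_bounded_def by blast
  have "{x \<in> V. \<epsilon> \<le> x} \<subseteq> K"
  proof
    fix y assume y: "y \<in> {x \<in> V. \<epsilon> \<le> x}"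
    then obtain x where "x \<in> K" "dmax x y < \<epsilon>" using K by auto
    with y show "y \<in> K" by (auto simp: dmax_def split: if_splits)
  qed
  with \<open>finite K\<close> show ?thesis by (rule rev_finite_subset)
qed

text \<open>Above a positive member of \<open>S\<close> there are only finitely many others, so a
  maximum exists among them; with no positive member, \<open>S\<close> is
  \<open>{0}\<close>.\<close>

lemma has_greatest_element:
  assumes "S \<subseteq> V" "S \<noteq> {}"
  obtains x where "x \<in> S" "\<And>y. y \<in> S \<Longrightarrow> y \<le> x"
proof (cases "\<exists>x\<in>S. 0 < x")
  case True
  then obtain x where x: "x \<in> S" "0 < x" by blast
  let ?T = "{y \<in> S. x \<le> y}"
  have fin: "finite ?T"
    by (rule finite_subset[OF _ finite_upper_part[OF x(2)]]) (use assms in auto)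
  have "Max ?T \<in> ?T" using fin x by (intro Max_in) auto
  moreover have "y \<le> Max ?T" if "y \<in> S" for y
  proof (cases "x \<le> y")
    case True then show ?thesis using fin that by (intro Max_ge) auto
  next
    case False
    moreover have "x \<le> Max ?T" using fin x by (intro Max_ge) auto
    ultimately show ?thesis by linarith
  qed
  ultimately show thesis using that by auto
next
  case False
  then have "y = 0" if "y \<in> S" for y using that assms ge_zero by fastforce
  with assms(2) show thesis using that by (metis order_refl all_not_in_conv)
qed

lemma Sup_in: assumes "S \<subseteq> V" "S \<noteq> {}" shows "Sup S \<in> S"
  using has_greatest_element[OF assms] by (metis cSup_eq_maximum)

text \<open>A positive infimum makes \<open>S\<close> finite and is attained. An infimum 0 may fail
  to be attained, but 0 belongs to every Goedel set; hence \<open>V\<close> rather than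
  \<open>S\<close> in the conclusion.\<close>

lemma Inf_in: assumes "S \<subseteq> V" "S \<noteq> {}" shows "Inf S \<in> V"
proof (cases "0 < Inf S")
  case True
  have "S \<subseteq> {x \<in> V. Inf S \<le> x}"
    using assms bdd(2) by (auto intro: cInf_lower)
  then have "finite S" using finite_upper_part[OF True] finite_subset by blast
  then show ?thesis using assms Min_in cInf_eq_Min by (metis subsetD)
next
  case False
  moreover have "0 \<le> Inf S" using assms ge_zero by (intro cInf_greatest) auto
  ultimately show ?thesis using zero_in by simp
qed

section \<open>Limits with respect to \<open>dmax\<close>\<close>

lemma limitin_iff:
  "limitin (dmax_topology V) r l D \<longleftrightarrow>
     l \<in> V \<and> (\<forall>\<epsilon>>0. \<forall>\<^sub>F i in D. r i \<in> V \<and> (r i = l \<or> r i < \<epsilon> \<and> l < \<epsilon>))"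
proof -
  interpret Metric_space V dmax by (rule Metric_space_dmax)
  \<comment> \<open>On nonnegative reals, distinct points are \<open>\<epsilon>\<close>-close
    exactly when both lie below \<open>\<epsilon>\<close>.\<close>
  have "(r i \<in> V \<and> dmax (r i) l < \<epsilon>) \<longleftrightarrow> (r i \<in> V \<and> (r i = l \<or> r i < \<epsilon> \<and> l < \<epsilon>))"
    if "0 < \<epsilon>" "l \<in> V" for i \<epsilon>
    using that ge_zero by (auto simp: dmax_def)
  then show ?thesis unfolding dmax_topology_def limitin_metric by (simp cong: conj_cong)
qed

lemma limitin_pos_iff:
  assumes "0 < l"
  shows "limitin (dmax_topology V) r l D \<longleftrightarrow> l \<in> V \<and> (\<forall>\<^sub>F i in D. r i = l)"
proof (intro iffI conjI)
  assume lim: "limitin (dmax_topology V) r l D"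
  then show "l \<in> V" by (simp add: limitin_iff)
  \<comment> \<open>The radius is \<open>l\<close> itself, which rules out the second disjunct: a
    positive point is isolated.\<close>
  have "\<forall>\<^sub>F i in D. r i \<in> V \<and> (r i = l \<or> r i < l \<and> l < l)"
    using lim assms by (simp only: limitin_iff)
  then show "\<forall>\<^sub>F i in D. r i = l" by eventually_elim simp
next
  assume r: "l \<in> V \<and> (\<forall>\<^sub>F i in D. r i = l)"
  then have "\<forall>\<^sub>F i in D. r i \<in> V \<and> (r i = l \<or> r i < \<epsilon> \<and> l < \<epsilon>)" for \<epsilon>
    by (elim conjE eventually_mono) simp
  with r show "limitin (dmax_topology V) r l D" by (simp add: limitin_iff)
qed

lemma limitin_zero_iff:
  "limitin (dmax_topology V) r 0 D \<longleftrightarrow> (\<forall>\<epsilon>>0. \<forall>\<^sub>F i in D. r i \<in> V \<and> r i < \<epsilon>)"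
proof -
  have "(r i \<in> V \<and> (r i = 0 \<or> r i < \<epsilon> \<and> 0 < \<epsilon>)) \<longleftrightarrow> r i \<in> V \<and> r i < \<epsilon>"
    if "0 < \<epsilon>" for i \<epsilon>
    using that by auto
  then show ?thesis using zero_in by (simp add: limitin_iff)
qed

text \<open>Two points of \<open>[0, \<epsilon>)\<close> also have usual distance below
  \<open>\<epsilon>\<close>. This makes order and uniqueness facts about real limits available for
  \<open>dmax\<close>.\<close>

lemma limitin_imp_tendsto:
  assumes "limitin (dmax_topology V) r l D"
  shows "(r \<longlongrightarrow> l) D"
proof (rule tendstoI)
  fix \<epsilon> :: real assume "0 < \<epsilon>"
  with assms have "l \<in> V" and ev: "\<forall>\<^sub>F i in D. r i \<in> V \<and> (r i = l \<or> r i < \<epsilon> \<and> l < \<epsilon>)"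
    unfolding limitin_iff by blast+
  from ev show "\<forall>\<^sub>F i in D. dist (r i) l < \<epsilon>"
  proof (rule eventually_mono)
    fix i assume elim: "r i \<in> V \<and> (r i = l \<or> r i < \<epsilon> \<and> l < \<epsilon>)"
    then have "0 \<le> r i" "0 \<le> l" using \<open>l \<in> V\<close> ge_zero by auto
    with elim \<open>0 < \<epsilon>\<close> show "dist (r i) l < \<epsilon>" by (auto simp: dist_real_def)
  qed
qed

lemma limitin_mono:
  assumes "D \<noteq> bot" "limitin (dmax_topology V) r l D" "limitin (dmax_topology V) s m D"
    and "\<forall>\<^sub>F i in D. r i \<le> s i"
  shows "l \<le> m"
  using tendsto_le[OF assms(1) limitin_imp_tendsto limitin_imp_tendsto] assms by blast

lemma limitin_unique:
  assumes "D \<noteq> bot" "limitin (dmax_topology V) r l D" "limitin (dmax_topology V) r m D"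
  shows "l = m"
  using tendsto_unique assms limitin_imp_tendsto by blast

lemma limitin_max:
  assumes "limitin (dmax_topology V) r l D" "limitin (dmax_topology V) s m D"
  shows "limitin (dmax_topology V) (\<lambda>i. max (r i) (s i)) (max l m) D"
  unfolding limitin_iff
proof (intro conjI allI impI)
  show "max l m \<in> V" using assms by (auto simp: limitin_iff max_def)
  fix \<epsilon> :: real assume "0 < \<epsilon>"
  with assms have "\<forall>\<^sub>F i in D. r i \<in> V \<and> (r i = l \<or> r i < \<epsilon> \<and> l < \<epsilon>)"
    "\<forall>\<^sub>F i in D. s i \<in> V \<and> (s i = m \<or> s i < \<epsilon> \<and> m < \<epsilon>)"
    unfolding limitin_iff by blast+
  then show "\<forall>\<^sub>F i in D. max (r i) (s i) \<in> V \<and>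
      (max (r i) (s i) = max l m \<or> max (r i) (s i) < \<epsilon> \<and> max l m < \<epsilon>)"
    by eventually_elim (auto simp: max_def)
qed

text \<open>In the usual topology implication is discontinuous where the two arguments meet. For
  \<open>dmax\<close>, if \<open>m = 0\<close> the values are bounded by \<open>s i\<close> and tend
  to 0. If \<open>m > 0\<close>, then eventually \<open>s i = m\<close>, while \<open>r i\<close>
  equals \<open>l\<close> or lies with \<open>l\<close> below \<open>m\<close>, so the comparison is
  eventually constant.\<close>

lemma limitin_impl:
  assumes r: "limitin (dmax_topology V) r l D" and s: "limitin (dmax_topology V) s m D"
  shows "limitin (dmax_topology V) (\<lambda>i. if s i \<le> r i then 0 else s i) (if m \<le> l then 0 else m) D"
proof -
  have V: "l \<in> V" "m \<in> V" using assms by (auto simp: limitin_iff)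
  show ?thesis
  proof (cases "m = 0")
    case True
    then have "\<forall>\<^sub>F i in D. (if s i \<le> r i then 0 else s i) \<in> V \<and> (if s i \<le> r i then 0 else s i) < \<epsilon>"
      if "0 < \<epsilon>" for \<epsilon>
      using s that zero_in by (auto simp: limitin_zero_iff elim!: eventually_mono)
    with True show ?thesis by (simp add: limitin_zero_iff)
  next
    case False
    with ge_zero V have m: "0 < m" by force
    then have sm: "\<forall>\<^sub>F i in D. s i = m" using s limitin_pos_iff by blast
    have "\<forall>\<^sub>F i in D. r i \<in> V \<and> (r i = l \<or> r i < m \<and> l < m)"
      using r m unfolding limitin_iff by blast
    with sm have "\<forall>\<^sub>F i in D. (if m \<le> l then 0 else m) = (if s i \<le> r i then 0 else s i)"
      by eventually_elim auto
    then show ?thesis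
      by (rule limitin_transform_eventually)
        (use V zero_in in auto)
  qed
qed

end

section \<open>Limits along an ultrafilter\<close>

lemma ultrafilter_on_cases:
  assumes "ultrafilter_on I D"
  obtains "\<forall>\<^sub>F i in D. P i" | "\<forall>\<^sub>F i in D. \<not> P i"
proof -
  have "(\<forall>\<^sub>F i in D. i \<in> {i \<in> I. P i}) \<or> (\<forall>\<^sub>F i in D. i \<in> I - {i \<in> I. P i})"
    by (rule assms[unfolded ultrafilter_on_def, THEN conjunct2, THEN conjunct2, rule_format]) blast
  then show thesis
  proof
    assume "\<forall>\<^sub>F i in D. i \<in> {i \<in> I. P i}"
    then have "\<forall>\<^sub>F i in D. P i" by eventually_elim simp
    then show thesis by (rule that)
  next
    assume "\<forall>\<^sub>F i in D. i \<in> I - {i \<in> I. P i}"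
    then have "\<forall>\<^sub>F i in D. \<not> P i" by eventually_elim simp
    then show thesis by (rule that)
  qed
qed

context compact_godel_set
begin

text \<open>If the values eventually drop below each \<open>\<epsilon>\<close>, the limit is 0.
  Otherwise some \<open>\<epsilon>\<close> keeps them eventually in a finite upper part, and an
  ultrafilter makes a function with finitely many values eventually constant.\<close>

lemma limitin_exists:
  assumes D: "ultrafilter_on I D" and r: "\<forall>\<^sub>F i in D. r i \<in> V"
  obtains l where "limitin (dmax_topology V) r l D"
proof (cases "\<forall>\<epsilon>>0. \<forall>\<^sub>F i in D. r i < \<epsilon>")
  case True
  with r have "limitin (dmax_topology V) r 0 D"
    by (auto simp: limitin_zero_iff intro: eventually_conj)
  then show thesis by (rule that)
next
  case False
  then obtain \<epsilon> where \<epsilon>: "0 < \<epsilon>" "\<not> (\<forall>\<^sub>F i in D. r i < \<epsilon>)" by blast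
  let ?F = "{x \<in> V. \<epsilon> \<le> x}"
  have "\<forall>\<^sub>F i in D. \<not> r i < \<epsilon>"
    using ultrafilter_on_cases[OF D, of "\<lambda>i. r i < \<epsilon>"] \<epsilon>(2) by blast
  with r have F: "\<forall>\<^sub>F i in D. r i \<in> ?F" by eventually_elim auto
  have "\<exists>x\<in>?F. \<forall>\<^sub>F i in D. r i = x"
  proof (rule ccontr)
    assume none: "\<not> ?thesis"
    have "\<forall>\<^sub>F i in D. r i \<noteq> x" if "x \<in> ?F" for x
      using ultrafilter_on_cases[OF D, of "\<lambda>i. r i = x"] none that by blast
    then have "\<forall>\<^sub>F i in D. \<forall>x\<in>?F. r i \<noteq> x"
      using finite_upper_part[OF \<epsilon>(1)] by (intro eventually_ball_finite) auto
    with F have "\<forall>\<^sub>F i in D. False" by eventually_elim auto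
    then show False using D by (simp add: ultrafilter_on_def eventually_False)
  qed
  then obtain x where "x \<in> V" "0 < x" "\<forall>\<^sub>F i in D. r i = x" using \<epsilon>(1) by auto
  then show thesis using that limitin_pos_iff by blast
qed

lemma limitin_filter_lim:
  assumes "ultrafilter_on I D" "\<forall>\<^sub>F i in D. r i \<in> V"
  shows "limitin (dmax_topology V) r (filter_lim V D r) D"
proof -
  obtain l where l: "limitin (dmax_topology V) r l D" using limitin_exists[OF assms] .
  moreover have "D \<noteq> bot" using assms(1) by (simp add: ultrafilter_on_def)
  ultimately have "filter_lim V D r = l"
    unfolding filter_lim_def by (blast intro: limitin_unique)
  with l show ?thesis by simp
qed

end

section \<open>Values of terms and formulas in a single structure\<close>

lemma term_val_in_univ:
  assumes "is_structure V L M" "is_term L t" "\<And>x. x \<in> term_vars t \<Longrightarrow> e x \<in> univ M"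
  shows "term_val M e t \<in> univ M"
  using assms(2,3)
proof (induction t)
  case (App f ts)
  then have "set (map (term_val M e) ts) \<subseteq> univ M"
    by (auto simp: list_all_iff)
  with App.prems(1) assms(1) show ?case
    unfolding is_structure_def by (simp del: set_map)
qed simp

text \<open>The quantifier cases rest on \<open>Sup_in\<close> and \<open>Inf_in\<close>, so
  compactness is what keeps quantified values in \<open>V\<close>.\<close>

lemma (in compact_godel_set) form_val_in:
  assumes "is_structure V L M" "is_formula L \<phi>" "\<And>x. x \<in> free_vars \<phi> \<Longrightarrow> e x \<in> univ M"
  shows "form_val M e \<phi> \<in> V"
  using assms(2,3)
proof (induction \<phi> arbitrary: e)
  case (Atom R ts)
  then have "set (map (term_val M e) ts) \<subseteq> univ M"
    using term_val_in_univ[OF assms(1)] by (fastforce simp: list_all_iff)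
  with Atom.prems(1) assms(1) show ?case
    unfolding is_structure_def by (simp del: set_map)
next
  case (All y \<psi>)
  have "(\<lambda>b. form_val M (e(y := b)) \<psi>) ` univ M \<subseteq> V"
    using All by auto
  with Sup_in[OF this] assms(1) show ?case by (auto simp: is_structure_def)
next
  case (Exi y \<psi>)
  have "(\<lambda>b. form_val M (e(y := b)) \<psi>) ` univ M \<subseteq> V"
    using Exi by auto
  with Inf_in[OF this] assms(1) show ?case by (auto simp: is_structure_def)
qed (auto simp: zero_in one_in max_def)

section \<open>The ultraproduct and the induction on formulas\<close>

locale godel_ultraproduct = compact_godel_set V
  for V :: "real set" +
  fixes L :: "('f, 'p) language" and I :: "'i set"
    and Ms :: "'i \<Rightarrow> ('f, 'p, 'a) fo_struct" and D :: "'i filter"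
  assumes structures: "i \<in> I \<Longrightarrow> is_structure V L (Ms i)"
    and ultra: "ultrafilter_on I D"
begin

abbreviation U :: "('f, 'p, 'i \<Rightarrow> 'a) fo_struct" where
  "U \<equiv> ultraproduct V I D Ms"

lemma eventually_I: "\<forall>\<^sub>F i in D. i \<in> I" and not_bot: "D \<noteq> bot"
  using ultra by (simp_all add: ultrafilter_on_def)

lemma univ_U: "univ U = (\<Pi>\<^sub>E i\<in>I. univ (Ms i))"
  by (simp add: ultraproduct_def)

lemma univ_nonempty: "i \<in> I \<Longrightarrow> univ (Ms i) \<noteq> {}"
  using structures by (auto simp: is_structure_def)

text \<open>Supplies the quantifier witnesses by choice in each coordinate; restriction to
  \<open>I\<close> makes the chosen function extensional, as \<open>PiE\<close> demands.\<close>

lemma choose_in_univ_U: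
  assumes "\<And>i. i \<in> I \<Longrightarrow> \<exists>b\<in>univ (Ms i). P i b"
  obtains b where "b \<in> univ U" "\<And>i. i \<in> I \<Longrightarrow> P i (b i)"
proof -
  obtain b where "\<forall>i\<in>I. b i \<in> univ (Ms i) \<and> P i (b i)" using assms by metis
  then show thesis
    using that[of "restrict b I"] by (simp add: univ_U)
qed

lemma univ_U_nonempty: "univ U \<noteq> {}"
  using univ_nonempty by (simp add: univ_U PiE_eq_empty_iff)

text \<open>Function symbols act coordinatewise, so evaluation commutes with projection to a
  coordinate in \<open>I\<close>; outside \<open>I\<close> the \<open>restrict\<close> in
  \<open>fun_int\<close> would return \<open>undefined\<close>.\<close>

lemma term_val_U:
  assumes "i \<in> I" "\<And>x. x \<in> term_vars t \<Longrightarrow> e' x = e x i"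
  shows "term_val U e t i = term_val (Ms i) e' t"
  using assms(2)
proof (induction t)
  case (App f ts)
  then have "map (\<lambda>t. term_val U e t i) ts = map (term_val (Ms i) e') ts"
    by auto
  then have "fun_int (Ms i) f (map (\<lambda>t. term_val U e t i) ts) =
      fun_int (Ms i) f (map (term_val (Ms i) e') ts)"
    by (rule arg_cong)
  with assms(1) show ?case by (simp add: ultraproduct_def o_def)
qed simp

text \<open>Separate assignments \<open>e' i\<close>, agreeing with \<open>\<lambda>x. e x i\<close> only on the free
  variables, spare a coincidence lemma: \<open>form_val_at\<close> leaves the other variables
  unspecified, so there the assignments need neither agree nor take values in the universe.\<close>

lemma los:
  assumes "is_formula L \<phi>" "\<And>x. x \<in> free_vars \<phi> \<Longrightarrow> e x \<in> univ U"
    and "\<And>i x. i \<in> I \<Longrightarrow> x \<in> free_vars \<phi> \<Longrightarrow> e' i x = e x i"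
  shows "limitin (dmax_topology V) (\<lambda>i. form_val (Ms i) (e' i) \<phi>) (form_val U e \<phi>) D"
  using assms
proof (induction \<phi> arbitrary: e e')
  case (Atom R ts)
  let ?r = "\<lambda>i. form_val (Ms i) (e' i) (Atom R ts)"
  \<comment> \<open>This is the family whose \<open>filter_lim\<close> defines the atom in
    \<open>U\<close>. It agrees with \<open>?r\<close> on \<open>I\<close>, a set belonging to
    \<open>D\<close>.\<close>
  let ?s = "\<lambda>i. pred_int (Ms i) R (map (\<lambda>t. term_val U e t i) ts)"
  have eq: "?s i = ?r i" if "i \<in> I" for i
  proof -
    have "map (\<lambda>t. term_val U e t i) ts = map (term_val (Ms i) (e' i)) ts"
      using that Atom.prems by (auto intro!: term_val_U)
    then show ?thesis by (simp only: form_val.simps)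
  qed
  have "?r i \<in> V" if "i \<in> I" for i
    using that Atom.prems by (intro form_val_in[OF structures]) (fastforce simp: univ_U PiE_iff)+
  with eq eventually_I have "\<forall>\<^sub>F i in D. ?s i \<in> V"
    by (auto elim!: eventually_mono)
  from limitin_filter_lim[OF ultra this]
  have "limitin (dmax_topology V) ?s (form_val U e (Atom R ts)) D"
    by (simp add: ultraproduct_def o_def)
  then show ?case
    by (rule limitin_transform_eventually[OF eventually_mono[OF eventually_I], rotated]) (rule eq)
next
  case Falsum
  then show ?case using one_in by (simp add: limitin_pos_iff)
next
  case (SConj \<phi> \<psi>)
  then show ?case by (simp add: limitin_max)
next
  case (Impl \<phi> \<psi>)
  then show ?case by (simp add: limitin_impl)
next
  case (WConj \<phi> \<psi>)
  then show ?case by (simp add: limitin_max)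
next
  case (All y \<psi>)
  let ?s = "\<lambda>i. form_val (Ms i) (e' i) (All y \<psi>)"
  let ?r = "\<lambda>i c. form_val (Ms i) ((e' i)(y := c)) \<psi>"
  have IH: "limitin (dmax_topology V) (\<lambda>i. ?r i (c i)) (form_val U (e(y := c)) \<psi>) D"
    if "c \<in> univ U" for c
    using that All.prems by (intro All.IH) auto
  have sub: "?r i ` univ (Ms i) \<subseteq> V" if "i \<in> I" for i
    using that All.prems by (auto simp: univ_U PiE_iff intro!: form_val_in[OF structures])
  have "\<exists>c\<in>univ (Ms i). ?s i = ?r i c" if "i \<in> I" for i
    using Sup_in[OF sub[OF that]] univ_nonempty[OF that] by auto
  then obtain b where b: "b \<in> univ U" "\<And>i. i \<in> I \<Longrightarrow> ?s i = ?r i (b i)"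
    using choose_in_univ_U[of "\<lambda>i c. ?s i = ?r i c"] by blast
  \<comment> \<open>Since \<open>b\<close> attains the supremum in each coordinate, the induction
    hypothesis at \<open>b\<close> already computes the limit of the suprema; it remains to see that
    \<open>b\<close> is also maximal in \<open>U\<close>.\<close>
  have lim: "limitin (dmax_topology V) ?s (form_val U (e(y := b)) \<psi>) D"
    by (rule limitin_transform_eventually[OF eventually_mono[OF eventually_I] IH[OF b(1)]])
      (simp only: b(2))
  have "form_val U (e(y := c)) \<psi> \<le> form_val U (e(y := b)) \<psi>" if c: "c \<in> univ U" for c
  proof (rule limitin_mono[OF not_bot IH[OF c] lim])
    show "\<forall>\<^sub>F i in D. ?r i (c i) \<le> ?s i"
      using eventually_I
      by eventually_elim (use c sub in \<open>auto simp: univ_U PiE_iff intro!: cSUP_upper bdd\<close>)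
  qed
  then have "form_val U e (All y \<psi>) = form_val U (e(y := b)) \<psi>"
    using b(1) by (auto intro!: cSup_eq_maximum)
  with lim show ?case by simp
next
  case (Exi y \<psi>)
  let ?m = "\<lambda>i. form_val (Ms i) (e' i) (Exi y \<psi>)"
  let ?r = "\<lambda>i c. form_val (Ms i) ((e' i)(y := c)) \<psi>"
  let ?u = "\<lambda>c. form_val U (e(y := c)) \<psi>"
  have IH: "limitin (dmax_topology V) (\<lambda>i. ?r i (c i)) (?u c) D" if "c \<in> univ U" for c
    using that Exi.prems by (intro Exi.IH) auto
  have sub: "?r i ` univ (Ms i) \<subseteq> V" if "i \<in> I" for i
    using that Exi.prems by (auto simp: univ_U PiE_iff intro!: form_val_in[OF structures])
  have "?m i \<in> V" if "i \<in> I" for i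
    using that Exi.prems by (intro form_val_in[OF structures]) (auto simp: univ_U PiE_iff)
  with eventually_I have "\<forall>\<^sub>F i in D. ?m i \<in> V" by (rule eventually_mono)
  \<comment> \<open>Infima need not be attained, so no witness yields the limit directly. It is
    obtained from the ultrafilter first and then identified with the infimum in
    \<open>U\<close>.\<close>
  from limitin_exists[OF ultra this]
  obtain l where l: "limitin (dmax_topology V) ?m l D" .
  have lower: "l \<le> ?u c" if c: "c \<in> univ U" for c
  proof (rule limitin_mono[OF not_bot l IH[OF c]])
    show "\<forall>\<^sub>F i in D. ?m i \<le> ?r i (c i)"
      using eventually_I
      by eventually_elim (use c sub in \<open>auto simp: univ_U PiE_iff intro!: cINF_lower bdd\<close>)
  qed
  have approx: "\<exists>b\<in>univ U. ?u b \<le> l + \<epsilon>" if \<epsilon>: "0 < \<epsilon>" for \<epsilon>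
  proof -
    have "\<exists>c\<in>univ (Ms i). ?r i c < ?m i + \<epsilon>" if i: "i \<in> I" for i
      using cInf_lessD[of "?r i ` univ (Ms i)" "?m i + \<epsilon>"] univ_nonempty[OF i] \<epsilon> by auto
    then obtain b where b: "b \<in> univ U" "\<And>i. i \<in> I \<Longrightarrow> ?r i (b i) < ?m i + \<epsilon>"
      using choose_in_univ_U[of "\<lambda>i c. ?r i c < ?m i + \<epsilon>"] by blast
    have "?u b \<le> l + \<epsilon>"
    \<comment> \<open>The shifted values \<open>?m i + \<epsilon>\<close> may leave
      \<open>V\<close>, so the comparison takes place in the usual topology instead of via
      \<open>limitin_mono\<close>.\<close>
    proof (rule tendsto_le[OF not_bot _ limitin_imp_tendsto[OF IH[OF b(1)]]])
      show "((\<lambda>i. ?m i + \<epsilon>) \<longlongrightarrow> l + \<epsilon>) D"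
        by (intro tendsto_add tendsto_const limitin_imp_tendsto l)
      show "\<forall>\<^sub>F i in D. ?r i (b i) \<le> ?m i + \<epsilon>"
        using eventually_I by eventually_elim (use b(2) in fastforce)
    qed
    with b(1) show ?thesis by blast
  qed
  have "form_val U e (Exi y \<psi>) = l"
    unfolding form_val.simps
  proof (rule cInf_eq_non_empty)
    fix z assume z: "\<And>x. x \<in> ?u ` univ U \<Longrightarrow> z \<le> x"
    show "z \<le> l"
    proof (rule field_le_epsilon)
      fix \<epsilon> :: real assume "0 < \<epsilon>"
      from approx[OF this] z show "z \<le> l + \<epsilon>" by force
    qed
  qed (use univ_U_nonempty lower in auto)
  with l show ?case by simp
qed

end

theorem theorem7p9:
  fixes V :: "real set"
    and L :: "('f, 'p) language"
    and I :: "'i set"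
    and Ms :: "'i \<Rightarrow> ('f, 'p, 'a) fo_struct"
    and D :: "'i filter"
    and \<phi> :: "('f, 'p) fo_form"
    and xs :: "nat list"
    and as :: "('i \<Rightarrow> 'a) list"
  assumes "godel_set V"
    and "compact_space (dmax_topology V)"
    and "Hausdorff_space (dmax_topology V)"
    and "\<And>i. i \<in> I \<Longrightarrow> is_structure V L (Ms i)"
    and "ultrafilter_on I D"
    and "is_formula L \<phi>"
    and "distinct xs"
    and "free_vars \<phi> \<subseteq> set xs"
    and "length as = length xs"
    and "set as \<subseteq> univ (ultraproduct V I D Ms)"
  shows "limitin (dmax_topology V)
           (\<lambda>i. form_val_at (Ms i) \<phi> xs (map (\<lambda>a. a i) as))
           (form_val_at (ultraproduct V I D Ms) \<phi> xs as) D"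
proof -
  interpret godel_ultraproduct V L I Ms D
    using assms by unfold_locales auto
  \<comment> \<open>The conditions of \<open>los\<close> concern free variables, where the lookup
    succeeds; outside \<open>xs\<close> it is \<open>the None\<close>.\<close>
  have *: "\<exists>a\<in>set as. map_of (zip xs as) x = Some a" if "x \<in> free_vars \<phi>" for x
  proof -
    have "x \<in> dom (map_of (zip xs as))" using that assms by (auto simp: dom_map_of_zip)
    then obtain a where a: "map_of (zip xs as) x = Some a" by blast
    then show ?thesis by (meson map_of_SomeD set_zip_rightD)
  qed
  show ?thesis
    unfolding form_val_at_def
  proof (rule los)
    fix x assume "x \<in> free_vars \<phi>"
    then obtain a where "a \<in> set as" and a: "map_of (zip xs as) x = Some a"
      using * by blast
    then show "the (map_of (zip xs as) x) \<in> univ U" using assms(10) by auto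
    fix i
    show "the (map_of (zip xs (map (\<lambda>a. a i) as)) x) = the (map_of (zip xs as) x) i"
      using a by (simp add: zip_map2 map_of_map)
  qed (rule assms(6))
qed

end
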